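(* Let $(a_n)_{n\ge1}$ be a sequence of positive integers, $n\ge1$, and let $x_0,x_n$ be integers with $2^{b_n}x_n-3^nx_0=B_n$, $1\le x_0<2^{b_n}$, $1\le x_n<3^n$. Define $x_k=\frac{3x_{k-1}+1}{2^{a_k}}$ for $1\le k\le n-1$, and suppose $x_i\ne x_j$ for all $0\le i<j\le n-1$. Then: (i) $\frac{B_n}{3^n}>\frac n3$ implies $x_k\le x_0$ for some $1\le k\le n-1$; (ii) $\frac{B_n}{3^n}<\frac n3$ implies $x_0\le x_k$ for some $1\le k\le n$; (iii) $\frac{B_n}{2^{b_n}}\le\frac n3$ implies $x_n\le x_i$ for some $0\le i\le n-1$; (iv) $\frac{B_n}{2^{b_n}}\ge\frac n3$ implies $x_n\ge x_k$ for some $0\le k\le n-1$.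
   Context: For a sequence $(a_n)_{n\ge1}$ of positive integers: $b_0=0$, $b_n=\sum_{i=1}^n a_i$, and $B_n=\sum_{i=0}^{n-1}3^{n-1-i}2^{b_i}$. *)

theory Defs
  imports Complex_Main
begin

text \<open>The sequence \<open>a\<close> is indexed from 1; the value \<open>a 0\<close> is never used.\<close>

definition b_seq :: "(nat \<Rightarrow> nat) \<Rightarrow> nat \<Rightarrow> nat" where
  "b_seq a n = (\<Sum>i=1..n. a i)"

definition B_seq :: "(nat \<Rightarrow> nat) \<Rightarrow> nat \<Rightarrow> nat" where
  "B_seq a n = (\<Sum>i<n. 3 ^ (n - 1 - i) * 2 ^ b_seq a i)"

end

theory Submission
  imports Defs
begin

text \<open>
  Extending the recursion to \<open>x\<^sub>n\<close> gives
  \<open>1 + B\<^sub>n / (3\<^sup>n x\<^sub>0) = (\<Prod>i<n. 1 + 1 / (3 x\<^sub>i))\<close> and, reciprocally,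
  \<open>1 - B\<^sub>n / (2 ^ b\<^sub>n x\<^sub>n) = (\<Prod>i<n. 1 - 1 / (3 x\<^sub>i + 1))\<close>.
  If all \<open>x\<^sub>i\<close> lie below \<open>x\<^sub>0\<close> (resp. above \<open>x\<^sub>n\<close>), Bernoulli's inequality bounds these products
  from below. If they lie above \<open>x\<^sub>0\<close> (resp. below \<open>x\<^sub>n\<close>), then, being distinct integers, they are
  spread out at least as much as consecutive integers, and a telescoping product bounds the
  products from above. Integrality of \<open>x\<^sub>k\<close> holds because both \<open>2 ^ b\<^sub>k x\<^sub>k\<close> and
  \<open>3 ^ (n - k) x\<^sub>k\<close> are integers.
\<close>

section \<open>Recurrences for \<open>b_seq\<close> and \<open>B_seq\<close>, and the affine
  recursion they solve\<close>

lemma b_seq_0 [simp]: "b_seq a 0 = 0"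
  by (simp add: b_seq_def)

lemma b_seq_Suc: "b_seq a (Suc k) = b_seq a k + a (Suc k)"
  by (simp add: b_seq_def)

lemma B_seq_0 [simp]: "B_seq a 0 = 0"
  by (simp add: B_seq_def)

lemma B_seq_Suc: "B_seq a (Suc k) = 3 * B_seq a k + 2 ^ b_seq a k"
proof -
  \<comment> \<open>At \<open>Suc k\<close> the exponent is \<open>k - i\<close>. Subtraction is
    truncated, so a factor 3 can be pulled out only for \<open>i < k\<close>; the summand
    \<open>i = k\<close> is the separate term \<open>2 ^ b_seq a k\<close>.\<close>
  have "(\<Sum>i<k. 3 ^ (k - i) * 2 ^ b_seq a i) = (\<Sum>i<k. 3 * (3 ^ (k - 1 - i) * 2 ^ b_seq a i) :: nat)"
  proof (rule sum.cong[OF refl])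
    fix i assume "i \<in> {..<k}"
    then have "k - i = Suc (k - 1 - i)" by auto
    then show "3 ^ (k - i) * 2 ^ b_seq a i = (3 * (3 ^ (k - 1 - i) * 2 ^ b_seq a i) :: nat)"
      by (simp only: power_Suc mult.assoc)
  qed
  then show ?thesis
    by (simp add: B_seq_def sum_distrib_left)
qed

lemma closed_form:
  fixes x :: "nat \<Rightarrow> real"
  assumes "\<And>i. i < k \<Longrightarrow> 2 ^ a (Suc i) * x (Suc i) = 3 * x i + 1"
  shows "2 ^ b_seq a k * x k = 3 ^ k * x 0 + real (B_seq a k)"
  using assms
proof (induction k)
  case (Suc k)
  have "2 ^ b_seq a (Suc k) * x (Suc k) = 2 ^ b_seq a k * (2 ^ a (Suc k) * x (Suc k))"
    by (simp add: b_seq_Suc power_add)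
  also have "\<dots> = 3 * (2 ^ b_seq a k * x k) + 2 ^ b_seq a k"
    using Suc.prems[of k] by (simp add: algebra_simps)
  also have "\<dots> = 3 ^ Suc k * x 0 + real (B_seq a (Suc k))"
    using Suc by (simp add: B_seq_Suc algebra_simps)
  finally show ?case .
qed simp

text \<open>The recursion is assumed only up to index \<open>n - 1\<close>; the final step is hidden
  in the equation for \<open>x n\<close>. Subtracting three times the closed form at
  \<open>m\<close> from the equation at \<open>Suc m\<close> and cancelling
  \<open>2 ^ b_seq a m\<close> recovers it.\<close>

lemma recurrence_last:
  fixes x :: "nat \<Rightarrow> real"
  assumes "\<And>i. i < m \<Longrightarrow> 2 ^ a (Suc i) * x (Suc i) = 3 * x i + 1"
    and "2 ^ b_seq a (Suc m) * x (Suc m) = 3 ^ Suc m * x 0 + real (B_seq a (Suc m))"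
  shows "2 ^ a (Suc m) * x (Suc m) = 3 * x m + 1"
proof -
  have "2 ^ b_seq a m * x m = 3 ^ m * x 0 + real (B_seq a m)"
    by (rule closed_form) (rule assms(1))
  then have "2 ^ b_seq a m * (2 ^ a (Suc m) * x (Suc m)) = 2 ^ b_seq a m * (3 * x m + 1)"
    using assms(2) by (simp add: b_seq_Suc B_seq_Suc power_add algebra_simps)
  then show ?thesis by simp
qed

lemma orbit_pos:
  fixes x :: "nat \<Rightarrow> real"
  assumes "\<And>i. i < n \<Longrightarrow> 2 ^ a (Suc i) * x (Suc i) = 3 * x i + 1" and "x 0 > 0" and "k \<le> n"
  shows "x k > 0"
  using \<open>k \<le> n\<close>
proof (induction k)
  case (Suc k)
  then have "2 ^ a (Suc k) * x (Suc k) > 0" using assms(1)[of k] by simp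
  then show ?case by (simp add: zero_less_mult_iff)
qed (use assms in simp)

section \<open>Integrality of the orbit\<close>

text \<open>Bezout: if \<open>u * p + v * q = 1\<close>, then \<open>y\<close> is an integer
  combination of \<open>p * y\<close> and \<open>q * y\<close>.\<close>

lemma Ints_if_coprime_multiples:
  fixes y :: real and p q :: int
  assumes "coprime p q" and "of_int p * y \<in> \<int>" and "of_int q * y \<in> \<int>"
  shows "y \<in> \<int>"
proof -
  obtain u v where "u * p + v * q = 1"
    using bezout_int[of p q] assms(1) by auto
  then have "of_int u * of_int p + of_int v * of_int q = (1 :: real)"
    by (metis of_int_1 of_int_add of_int_mult)
  then have "y = of_int u * (of_int p * y) + of_int v * (of_int q * y)"
    by (metis distrib_right mult.assoc mult_1)
  then show ?thesis
    using assms(2,3) by (metis Ints_add Ints_mult Ints_of_int)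
qed

lemma orbit_Ints:
  fixes x :: "nat \<Rightarrow> real"
  assumes rec: "\<And>i. i < n \<Longrightarrow> 2 ^ a (Suc i) * x (Suc i) = 3 * x i + 1"
    and "x 0 \<in> \<int>" and "x n \<in> \<int>" and "k \<le> n"
  shows "x k \<in> \<int>"
proof (rule Ints_if_coprime_multiples)
  show "coprime (2 ^ b_seq a k :: int) (3 ^ (n - k))"
    by simp
  have "2 ^ b_seq a k * x k = 3 ^ k * x 0 + real (B_seq a k)"
    using closed_form[of k a x] rec \<open>k \<le> n\<close> by simp
  then show "of_int (2 ^ b_seq a k) * x k \<in> \<int>"
    using \<open>x 0 \<in> \<int>\<close> by simp
  \<comment> \<open>Here the recursion is run backwards from \<open>x n\<close>: each of the
    \<open>j\<close> steps back divides by 3 once, so \<open>3 ^ j\<close> clears the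
    denominator.\<close>
  have "3 ^ j * x (n - j) \<in> \<int>" if "j \<le> n" for j
    using that
  proof (induction j)
    case (Suc j)
    define m where "m = n - Suc j"
    have m: "n - j = Suc m" "m < n" using Suc.prems by (auto simp: m_def)
    have "3 ^ Suc j * x m = 3 ^ j * (3 * x m + 1) - 3 ^ j"
      by (simp add: algebra_simps)
    also have "\<dots> = 2 ^ a (Suc m) * (3 ^ j * x (Suc m)) - 3 ^ j"
      unfolding rec[OF m(2), symmetric] by simp
    finally have "3 ^ Suc j * x m = 2 ^ a (Suc m) * (3 ^ j * x (Suc m)) - 3 ^ j" .
    moreover have "3 ^ j * x (Suc m) \<in> \<int>" using Suc m by simp
    ultimately show ?case unfolding m_def by simp
  qed (use \<open>x n \<in> \<int>\<close> in simp)
  from this[of "n - k"] \<open>k \<le> n\<close> show "of_int (3 ^ (n - k)) * x k \<in> \<int>"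
    by simp
qed

section \<open>Product formulas along the orbit\<close>

lemma orbit_prod:
  fixes x :: "nat \<Rightarrow> real"
  assumes "\<And>i. i < k \<Longrightarrow> 2 ^ a (Suc i) * x (Suc i) = 3 * x i + 1" and "\<And>i. i < k \<Longrightarrow> x i > 0"
  shows "3 ^ k * x 0 * (\<Prod>i<k. 1 + 1 / (3 * x i)) = 2 ^ b_seq a k * x k"
  using assms
proof (induction k)
  case (Suc k)
  have "3 ^ Suc k * x 0 * (\<Prod>i<Suc k. 1 + 1 / (3 * x i))
      = 3 * (3 ^ k * x 0 * (\<Prod>i<k. 1 + 1 / (3 * x i))) * (1 + 1 / (3 * x k))"
    by simp
  also have "\<dots> = 2 ^ b_seq a k * (3 * x k * (1 + 1 / (3 * x k)))"
    using Suc by simp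
  also have "3 * x k * (1 + 1 / (3 * x k)) = 3 * x k + 1"
    using Suc.prems(2)[of k] by (simp add: field_simps)
  also have "\<dots> = 2 ^ a (Suc k) * x (Suc k)"
    using Suc.prems(1)[of k] by simp
  finally show ?case by (simp add: b_seq_Suc power_add)
qed simp

text \<open>The factors \<open>(3 * x i + 1) / (3 * x i)\<close> and
  \<open>3 * x i / (3 * x i + 1)\<close> are mutually inverse, so this is \<open>orbit_prod\<close>
  solved for \<open>x 0\<close>.\<close>

lemma orbit_prod_inverse:
  fixes x :: "nat \<Rightarrow> real"
  assumes "\<And>i. i < k \<Longrightarrow> 2 ^ a (Suc i) * x (Suc i) = 3 * x i + 1" and "\<And>i. i < k \<Longrightarrow> x i > 0"
  shows "2 ^ b_seq a k * x k * (\<Prod>i<k. 1 - 1 / (3 * x i + 1)) = 3 ^ k * x 0"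
proof -
  let ?P = "\<Prod>i<k. 1 + 1 / (3 * x i)" and ?Q = "\<Prod>i<k. 1 - 1 / (3 * x i + 1)"
  have inv: "?P * ?Q = 1"
    unfolding prod.distrib[symmetric]
  proof (rule prod.neutral, rule ballI)
    fix i assume "i \<in> {..<k}"
    then have "x i > 0" using assms(2) by simp
    then have "3 * x i + 1 \<noteq> 0" by simp
    with \<open>x i > 0\<close> show "(1 + 1 / (3 * x i)) * (1 - 1 / (3 * x i + 1)) = 1"
      by (simp add: divide_simps)
  qed
  have "2 ^ b_seq a k * x k * ?Q = 3 ^ k * x 0 * ?P * ?Q"
    using orbit_prod[of k a x] assms by simp
  also have "\<dots> = 3 ^ k * x 0"
    by (simp only: mult.assoc inv mult_1_right)
  finally show ?thesis .
qed

section \<open>Bounds for products over distinct integers, and Bernoulli's bound\<close>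

text \<open>Elements are added in increasing order. With \<open>c\<close> elements already in
  \<open>[m, b)\<close>, the new maximum satisfies \<open>b \<ge> m + c\<close>, hence
  \<open>3 * b \<ge> 3 * m + c\<close>. This weaker bound makes the factors telescope:
  \<open>(3m+c+1)/(3m+c)\<close> times \<open>(3m+c)/(3m)\<close>.\<close>

lemma prod_distinct_ints_above:
  fixes m :: int
  assumes "finite A" and "m \<ge> 1" and "\<And>v. v \<in> A \<Longrightarrow> m \<le> v"
  shows "(\<Prod>v\<in>A. 1 + 1 / (3 * of_int v)) \<le> 1 + real (card A) / (3 * of_int m)"
  using assms
proof (induction A rule: finite_linorder_max_induct)
  case (insert b A)
  let ?c = "real (card A)"
  have "A \<subseteq> {m..<b}" using insert by auto
  from card_mono[OF _ this] have "int (card A) \<le> b - m"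
    using insert.prems(2)[of b] by simp
  then have "of_int (int (card A)) \<le> real_of_int (b - m)"
    by (simp only: of_int_le_iff)
  then have "3 * real_of_int m + ?c \<le> 3 * of_int b" by simp
  moreover have m: "real_of_int m > 0" using \<open>m \<ge> 1\<close> by simp
  ultimately have b: "1 + 1 / (3 * real_of_int b) \<le> 1 + 1 / (3 * of_int m + ?c)"
    by (intro add_left_mono divide_left_mono mult_pos_pos) auto
  have "b \<notin> A" using insert by auto
  then have "(\<Prod>v\<in>insert b A. 1 + 1 / (3 * of_int v))
      = (1 + 1 / (3 * real_of_int b)) * (\<Prod>v\<in>A. 1 + 1 / (3 * of_int v))"
    using insert by simp
  also have "\<dots> \<le> (1 + 1 / (3 * of_int m + ?c)) * (1 + ?c / (3 * of_int m))"
  proof (rule mult_mono[OF b])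
    show "(\<Prod>v\<in>A. 1 + 1 / (3 * of_int v)) \<le> 1 + ?c / (3 * of_int m)"
      using insert by simp
    show "(0::real) \<le> (\<Prod>v\<in>A. 1 + 1 / (3 * of_int v))"
      using insert.prems by (intro prod_nonneg) force
  qed (use m in simp)
  also have "\<dots> = 1 + (?c + 1) / (3 * of_int m)"
    using m by (simp add: divide_simps add_pos_nonneg)
  finally show ?case using insert \<open>b \<notin> A\<close> by (simp add: add.commute)
qed simp

text \<open>The mirror image, adding elements in decreasing order. The constant
  \<open>3 * m - 2\<close> is \<open>3 * (m - 1) + 1\<close>, the denominator at the largest
  admissible integer \<open>m - 1\<close>; writing it \<open>M\<close>, the factors telescope as
  \<open>(M-c-1)/(M-c)\<close> times \<open>(M-c)/M\<close>.\<close>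

lemma prod_distinct_ints_below:
  fixes m :: int
  assumes "finite A" and "\<And>v. v \<in> A \<Longrightarrow> 1 \<le> v \<and> v < m"
  shows "(\<Prod>v\<in>A. 1 - 1 / (3 * of_int v + 1)) \<le> 1 - real (card A) / (3 * of_int m - 2)"
  using assms
proof (induction A rule: finite_linorder_min_induct)
  case (insert b A)
  let ?c = "real (card A)" and ?M = "3 * real_of_int m - 2"
  have b1: "1 \<le> b" "b < m" using insert.prems[of b] by auto
  have "A \<subseteq> {b<..<m}" using insert by auto
  from card_mono[OF _ this] have "int (card A) \<le> m - 1 - b"
    using b1 by simp
  then have "of_int (int (card A)) \<le> real_of_int (m - 1 - b)"
    by (simp only: of_int_le_iff)
  then have le: "3 * real_of_int b + 1 \<le> ?M - ?c" by simp
  have bpos: "real_of_int b \<ge> 1" using b1 by simp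
  have M: "?M - ?c > 0" "?M > 0" using le bpos by linarith+
  have b: "1 - 1 / (3 * real_of_int b + 1) \<le> 1 - 1 / (?M - ?c)"
    using le M bpos by (intro diff_left_mono divide_left_mono mult_pos_pos) auto
  have "b \<notin> A" using insert by auto
  then have "(\<Prod>v\<in>insert b A. 1 - 1 / (3 * of_int v + 1))
      = (1 - 1 / (3 * real_of_int b + 1)) * (\<Prod>v\<in>A. 1 - 1 / (3 * of_int v + 1))"
    using insert by simp
  also have "\<dots> \<le> (1 - 1 / (?M - ?c)) * (1 - ?c / ?M)"
  proof (rule mult_mono[OF b])
    show "(\<Prod>v\<in>A. 1 - 1 / (3 * of_int v + 1)) \<le> 1 - ?c / ?M"
      using insert by simp
    show "(0::real) \<le> (\<Prod>v\<in>A. 1 - 1 / (3 * of_int v + 1))"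
      using insert.prems by (intro prod_nonneg) (force simp: divide_simps)
    show "0 \<le> 1 - 1 / (?M - ?c)"
      using M le bpos by (simp add: divide_simps)
  qed
  also have "\<dots> = 1 - (?c + 1) / ?M"
  proof -
    have "(1 - 1 / (N - c)) * (1 - c / N) = 1 - (c + 1) / N" if "N - c > 0" "N > 0" for N c :: real
      using that by (simp add: field_simps)
    then show ?thesis using M by blast
  qed
  finally show ?case using insert \<open>b \<notin> A\<close> by (simp add: add.commute)
qed simp

text \<open>Passes from an indexed product of reals to a product over a set of integers, where the
  counting bounds apply. On integral values the floor loses nothing, so it stays injective.\<close>

lemma prod_reindex_floor:
  fixes x :: "nat \<Rightarrow> real"
  assumes "inj_on x {..<n}" and "\<And>i. i < n \<Longrightarrow> x i \<in> \<int>"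
  shows "(\<Prod>i<n. g (x i)) = (\<Prod>v\<in>(\<lambda>i. \<lfloor>x i\<rfloor>) ` {..<n}. g (of_int v))"
    and "card ((\<lambda>i. \<lfloor>x i\<rfloor>) ` {..<n}) = n"
proof -
  have fl: "of_int \<lfloor>x i\<rfloor> = x i" if "i < n" for i
    using assms(2)[OF that] by (auto elim: Ints_cases)
  have inj: "inj_on (\<lambda>i. \<lfloor>x i\<rfloor>) {..<n}"
    using assms(1) fl by (metis (mono_tags, lifting) inj_on_def lessThan_iff)
  show "card ((\<lambda>i. \<lfloor>x i\<rfloor>) ` {..<n}) = n"
    using inj by (simp add: card_image)
  show "(\<Prod>i<n. g (x i)) = (\<Prod>v\<in>(\<lambda>i. \<lfloor>x i\<rfloor>) ` {..<n}. g (of_int v))"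
    by (simp add: prod.reindex[OF inj] fl del: floor_of_int cong: prod.cong_simp)
qed

lemma prod_ge_Bernoulli:
  fixes f :: "nat \<Rightarrow> real"
  assumes "\<And>i. i < n \<Longrightarrow> 1 + t \<le> f i" and "-1 \<le> t"
  shows "1 + real n * t \<le> (\<Prod>i<n. f i)"
proof -
  have "1 + real n * t \<le> (1 + t) ^ n"
    using Bernoulli_inequality[of t n] assms(2) by simp
  also have "\<dots> = (\<Prod>i<n. 1 + t)" by simp
  also have "\<dots> \<le> (\<Prod>i<n. f i)"
    using assms by (intro prod_mono) auto
  finally show ?thesis .
qed

theorem theorem4p10:
  fixes a :: "nat \<Rightarrow> nat" and n :: nat and x :: "nat \<Rightarrow> real"
  assumes a_pos: "\<And>k. k \<ge> 1 \<Longrightarrow> a k > 0"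
    and n_ge_1: "n \<ge> 1"
    and x0_int: "x 0 \<in> \<int>"
    and xn_int: "x n \<in> \<int>"
    and eq: "2 ^ b_seq a n * x n - 3 ^ n * x 0 = real (B_seq a n)"
    and x0_bounds: "1 \<le> x 0" "x 0 < 2 ^ b_seq a n"
    and xn_bounds: "1 \<le> x n" "x n < 3 ^ n"
    and rec: "\<And>k. 1 \<le> k \<Longrightarrow> k \<le> n - 1 \<Longrightarrow> x k = (3 * x (k - 1) + 1) / 2 ^ a k"
    and distinct: "\<And>i j. i < j \<Longrightarrow> j \<le> n - 1 \<Longrightarrow> x i \<noteq> x j"
  shows "(real (B_seq a n) / 3 ^ n > real n / 3 \<longrightarrow> (\<exists>k\<in>{1..n-1}. x k \<le> x 0))
    \<and> (real (B_seq a n) / 3 ^ n < real n / 3 \<longrightarrow> (\<exists>k\<in>{1..n}. x 0 \<le> x k))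
    \<and> (real (B_seq a n) / 2 ^ b_seq a n \<le> real n / 3 \<longrightarrow> (\<exists>i\<in>{0..n-1}. x n \<le> x i))
    \<and> (real (B_seq a n) / 2 ^ b_seq a n \<ge> real n / 3 \<longrightarrow> (\<exists>k\<in>{0..n-1}. x n \<ge> x k))"
proof -
  have rec': "2 ^ a (Suc i) * x (Suc i) = 3 * x i + 1" if "i < n - 1" for i
    using rec[of "Suc i"] that by simp
  have step: "2 ^ a (Suc i) * x (Suc i) = 3 * x i + 1" if "i < n" for i
  proof (cases "i < n - 1")
    case False
    then have n: "n = Suc i" using that by simp
    show ?thesis
      using recurrence_last[of i a x] rec' eq by (simp add: n)
  qed (rule rec')
  have pos: "x k > 0" if "k \<le> n" for k
    using orbit_pos[of n a x k] step x0_bounds that by simp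
  have ints: "x k \<in> \<int>" if "k \<le> n" for k
    using orbit_Ints[of n a x k] step x0_int xn_int that by simp
  have inj: "inj_on x {..<n}"
  proof (rule linorder_inj_onI)
    fix i j assume "i < j" "i \<in> {..<n}" "j \<in> {..<n}"
    then show "x i \<noteq> x j" using distinct[of i j] by simp
  qed auto
  define V where "V = (\<lambda>i. \<lfloor>x i\<rfloor>) ` {..<n}"
  have cardV: "card V = n" and finV: "finite V"
    and prodV: "(\<Prod>i<n. g (x i)) = (\<Prod>v\<in>V. g (of_int v))" for g :: "real \<Rightarrow> real"
    unfolding V_def using prod_reindex_floor[of x n] inj ints by auto
  obtain m0 where m0: "x 0 = of_int m0" using x0_int by (elim Ints_cases)
  obtain mn where mn: "x n = of_int mn" using xn_int by (elim Ints_cases)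
  define B where "B = real (B_seq a n)"
  define P where "P = (\<Prod>i<n. 1 + 1 / (3 * x i))"
  define Q where "Q = (\<Prod>i<n. 1 - 1 / (3 * x i + 1))"
  \<comment> \<open>Through \<open>P\<close> and \<open>Q\<close>, the first two claims compare
    \<open>x 0 * (P - 1)\<close> with \<open>n / 3\<close>, the last two
    \<open>x n * (1 - Q)\<close> with \<open>n / 3\<close>.\<close>
  have P: "B / 3 ^ n = x 0 * (P - 1)"
  proof -
    have "3 ^ n * (x 0 * (P - 1)) = B"
      using orbit_prod[of n a x] step pos eq by (simp add: P_def B_def algebra_simps)
    then show ?thesis by (simp add: field_simps)
  qed
  have Q: "B / 2 ^ b_seq a n = x n * (1 - Q)"
  proof -
    have "2 ^ b_seq a n * (x n * (1 - Q)) = B"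
      using orbit_prod_inverse[of n a x] step pos eq by (simp add: Q_def B_def algebra_simps)
    then show ?thesis by (simp add: field_simps)
  qed
  have "\<exists>k\<in>{1..n-1}. x k \<le> x 0" if "B / 3 ^ n > real n / 3"
  proof (rule ccontr)
    assume "\<not> ?thesis"
    then have gt: "x 0 < x k" if "1 \<le> k" "k \<le> n - 1" for k
      using that by (meson atLeastAtMost_iff not_le)
    have "x 0 \<le> x k" if "k < n" for k
      proof (cases "k = 0")
      case False
      then have "x 0 < x k" using that by (intro gt) linarith+
      then show ?thesis by simp
    qed simp
    then have "m0 \<le> v" if "v \<in> V" for v
      using that m0 by (auto simp: V_def le_floor_iff)
    then have "P \<le> 1 + real n / (3 * x 0)"
      using prod_distinct_ints_above[of V m0] finV cardV x0_bounds m0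
      by (simp add: P_def prodV[of "\<lambda>y. 1 + 1 / (3 * y)"])
    then have "x 0 * (P - 1) \<le> x 0 * (real n / (3 * x 0))"
      using x0_bounds by (intro mult_left_mono) auto
    then show False using that P x0_bounds by simp
  qed
  moreover have "\<exists>k\<in>{1..n}. x 0 \<le> x k" if "B / 3 ^ n < real n / 3"
  proof (rule ccontr)
    assume "\<not> ?thesis"
    then have lt: "x k < x 0" if "1 \<le> k" "k \<le> n" for k
      using that by (meson atLeastAtMost_iff not_le)
    have "1 + 1 / (3 * x 0) \<le> 1 + 1 / (3 * x k)" if "k < n" for k
    proof -
      \<comment> \<open>At \<open>k = 0\<close> there is equality. The weak comparison suffices, as
        the hypothesis on \<open>B\<close> is strict in this claim.\<close>
      have "x k \<le> x 0" using lt[of k] that by (cases "k = 0") simp_all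
      then show ?thesis using pos[of k] that by (simp add: divide_left_mono)
    qed
    moreover have "-1 \<le> 1 / (3 * x 0)"
      using x0_bounds by (simp add: divide_simps)
    ultimately have "1 + real n * (1 / (3 * x 0)) \<le> P"
      unfolding P_def by (rule prod_ge_Bernoulli)
    then have "x 0 * (real n * (1 / (3 * x 0))) \<le> x 0 * (P - 1)"
      using x0_bounds by (intro mult_left_mono) auto
    then show False using that P x0_bounds by simp
  qed
  moreover have "\<exists>i\<in>{0..n-1}. x n \<le> x i" if "B / 2 ^ b_seq a n \<le> real n / 3"
  proof (rule ccontr)
    assume "\<not> ?thesis"
    then have lt: "x k < x n" if "k < n" for k
    proof -
      have "k \<in> {0..n-1}" using that by simp
      with \<open>\<not> _\<close> show ?thesis by (meson not_le)
    qed
    have "1 \<le> v \<and> v < mn" if v: "v \<in> V" for v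
    proof -
      obtain i where i: "i < n" "v = \<lfloor>x i\<rfloor>" using v by (auto simp: V_def)
      then have "x i = of_int v" using ints[of i] by (auto elim: Ints_cases)
      then show ?thesis using lt[of i] pos[of i] i(1) mn by simp
    qed
    then have "Q \<le> 1 - real n / (3 * x n - 2)"
      using prod_distinct_ints_below[of V mn] finV cardV mn
      by (simp add: Q_def prodV[of "\<lambda>y. 1 - 1 / (3 * y + 1)"])
    \<comment> \<open>The hypothesis on \<open>B\<close> is not strict here; the \<open>- 2\<close>
      in the denominator supplies the strictness needed for a contradiction.\<close>
    moreover have "real n / (3 * x n) < real n / (3 * x n - 2)"
      using xn_bounds n_ge_1 by (intro divide_strict_left_mono) auto
    ultimately have "x n * (real n / (3 * x n)) < x n * (1 - Q)"
      using xn_bounds by (intro mult_strict_left_mono) auto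
    then show False using that Q xn_bounds by simp
  qed
  moreover have "\<exists>k\<in>{0..n-1}. x n \<ge> x k" if "B / 2 ^ b_seq a n \<ge> real n / 3"
  proof (rule ccontr)
    assume "\<not> ?thesis"
    then have gt: "x n < x k" if "k < n" for k
    proof -
      have "k \<in> {0..n-1}" using that by simp
      with \<open>\<not> _\<close> show ?thesis by (meson not_le)
    qed
    have "1 + - (1 / (3 * x n + 1)) \<le> 1 - 1 / (3 * x k + 1)" if "k < n" for k
    proof -
      have "1 / (3 * x k + 1) \<le> 1 / (3 * x n + 1)"
        using gt[OF that] xn_bounds by (intro divide_left_mono) auto
      then show ?thesis by simp
    qed
    then have "1 + real n * - (1 / (3 * x n + 1)) \<le> Q"
      unfolding Q_def using xn_bounds by (intro prod_ge_Bernoulli) (auto simp: divide_simps)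
    \<comment> \<open>Again the strict inequality comes from the denominators, this time from the
      \<open>+ 1\<close>.\<close>
    moreover have "real n / (3 * x n + 1) < real n / (3 * x n)"
      using xn_bounds n_ge_1 by (intro divide_strict_left_mono) auto
    ultimately have "x n * (1 - Q) < x n * (real n / (3 * x n))"
      using xn_bounds by (intro mult_strict_left_mono) auto
    then show False using that Q xn_bounds by simp
  qed
  ultimately show ?thesis unfolding B_def by blast
qed

end
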